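(* Assume the null hypothesis $H_0$ holds, i.e. $p(\mathbf{s},z)=p(\mathbf{s})P(z)$ for all $\mathbf{s}\in\mathcal{S}$ (features and labels are independent). Let $N_q$ be a label budget and let $\alpha\in[0,1]$ be a pre-specified significance level. Suppose an analyst uses the active sequential two-sample testing framework, with any query scheme and any class-probability predictors $Q_1,Q_2,\dots$ as described in the context, to sequentially query the oracle for the labels $Z$ of features $\mathbf{S}\in\mathcal{S}_u$, resulting in the sequence $(\mathbf{S}_1,Z_1),(\mathbf{S}_2,Z_2),\dots,(\mathbf{S}_n,Z_n)$, $n\le N_q$. Then $$P_0\left(\exists n\in[N_q],\ W_n=\prod_{i=1}^{n}\frac{\hat P(Z_i)}{Q_i(Z_i\mid \mathbf{S}_i)}\le \alpha\right)\le \alpha ,$$ where for each $n$ the factors $\hat P(Z_i)$, $1\le i\le n$, are computed with the class prior $\hat P(Z=1)=\frac1n\sum_{j=1}^n Z_j$, $\hat P(Z=0)=1-\hat P(Z=1)$, and $P_0$ denotes probability under $H_0$.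
   Context: Data. $(\mathbf{S},Z)$ is a feature-label pair with values in $\mathbb{R}^d\times\{0,1\}$ and joint distribution $p(\mathbf{s},z)$; $p(\mathbf{s})$ is the marginal of $\mathbf{S}$ with support $\mathcal{S}$, $P(z)$ is the marginal of $Z$, and $P(z\mid\mathbf{s})$ is the posterior probability of label $z$ given feature $\mathbf{s}$. An unlabeled feature set $\mathcal{S}_u$ is given, whose elements are realizations of random variables i.i.d. from $p(\mathbf{s})$. An oracle, when queried at a feature $\mathbf{s}_i\in\mathcal{S}_u$, returns its label $z_i$, generated from $P(\cdot\mid \mathbf{s}_i)$ (so that the underlying feature-label pairs, with labels initially unrevealed, are i.i.d. from $p(\mathbf{s},z)$). Framework. A class-probability predictor $Q(z\mid\mathbf{s})$ is a function with $Q(0\mid\mathbf{s})+Q(1\mid\mathbf{s})=1$ and $Q(z\mid\mathbf{s})\ge 0$ (the output of any probabilistic classifier). The analyst first initializes $Q_1(z\mid\mathbf{s})$ with a small set of features sampled uniformly at random from $\mathcal{S}_u$ without replacement and labeled by the oracle; these points are not used in the test statistic. Then, for $n=1,2,\dots,N_q$: based on the predictions of $Q_n$, the analyst selects a not-yet-labeled feature $\mathbf{S}_n\in\mathcal{S}_u$ and queries its label $Z_n$; the statistic $W_n$ is computed; $H_0$ is rejected and the procedure stops if $W_n\le\alpha$; otherwise, if budget remains, $Q_n$ is updated to $Q_{n+1}$ using the labeled pairs observed so far. Thus $Q_n$ depends only on the initialization set and on $(\mathbf{S}_i,Z_i)_{i\le n-1}$. $N_q$ counts the labels available after initialization, and $[N_q]=\{1,\dots,N_q\}$.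 *)

theory Defs
  imports "HOL-Probability.Probability"
begin

text \<open>Labels 0 and 1 are rendered by \<open>False\<close> and \<open>True\<close>; a distribution of feature-label pairs is a
  measure on the following space.\<close>

abbreviation pair_space :: "((real ^ 'd) \<times> bool) measure" where
  "pair_space \<equiv> borel \<Otimes>\<^sub>M count_space UNIV"

text \<open>\<open>p(s,z) = p(s) P(z)\<close>: the joint law is the product of its two marginals.\<close>

definition null_hypothesis :: "((real ^ 'd) \<times> bool) measure \<Rightarrow> bool" where
  "null_hypothesis p \<longleftrightarrow>
     p = distr p borel fst \<Otimes>\<^sub>M distr p (count_space UNIV) snd"

text \<open>\<open>q z s\<close> stands for \<open>Q(z | s)\<close>.\<close>

definition class_prob_predictor :: "(bool \<Rightarrow> 's \<Rightarrow> real) \<Rightarrow> bool" where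
  "class_prob_predictor q \<longleftrightarrow> (\<forall>s. q False s + q True s = 1 \<and> (\<forall>z. 0 \<le> q z s))"

text \<open>The pool of features is indexed by \<open>j < m\<close>, with features \<open>x j\<close> and latent labels \<open>y j\<close>. If the
  pool element with index \<open>idx i\<close> is labeled at time \<open>i\<close>, for \<open>i\<close> in the set \<open>T\<close> of times, the
  following are the labeled pairs in order of labeling. With \<open>x = id\<close> they show which
  indices were labeled, and with which results.\<close>

definition observed :: "nat set \<Rightarrow> (nat \<Rightarrow> 's) \<Rightarrow> (nat \<Rightarrow> bool) \<Rightarrow> (nat \<Rightarrow> nat) \<Rightarrow> nat \<Rightarrow> 's \<times> bool" where
  "observed T x y idx = (\<lambda>i\<in>T. (x (idx i), y (idx i)))"

text \<open>A learning rule turns the \<open>k\<close> labeled initialization pairs and the pairs labeled in queries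
  \<open>1, \<dots>, n - 1\<close> (and nothing else) into the predictor \<open>Q\<^sub>n\<close>.\<close>

definition learning_rule ::
    "nat \<Rightarrow> nat \<Rightarrow>
     (nat \<Rightarrow> (nat \<Rightarrow> (real ^ 'd) \<times> bool) \<Rightarrow> (nat \<Rightarrow> (real ^ 'd) \<times> bool) \<Rightarrow> bool \<Rightarrow> real ^ 'd \<Rightarrow> real) \<Rightarrow> bool"
  where
  "learning_rule k Nq L \<longleftrightarrow> (\<forall>n\<in>{1..Nq}.
     (\<forall>d h. class_prob_predictor (L n d h)) \<and>
     (\<forall>z. (\<lambda>(d, h, s). L n d h z s) \<in> borel_measurable
        (Pi\<^sub>M {..<k} (\<lambda>_. pair_space) \<Otimes>\<^sub>M Pi\<^sub>M {1..<n} (\<lambda>_. pair_space) \<Otimes>\<^sub>M borel)))"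

text \<open>A query scheme picks the index of the \<open>n\<close>-th query from the predictions \<open>q j = Q\<^sub>n(1 | x j)\<close>
  on the pool, the pool \<open>x\<close> itself, the initialization record \<open>r\<close> and the query record \<open>h\<close> (the
  indices labeled so far together with their labels), and a random seed \<open>u\<close>. The index must not
  have been labeled before.\<close>

definition query_scheme ::
    "nat \<Rightarrow> nat \<Rightarrow> nat \<Rightarrow> 'u measure \<Rightarrow>
     (nat \<Rightarrow> (nat \<Rightarrow> real) \<Rightarrow> (nat \<Rightarrow> real ^ 'd) \<Rightarrow> (nat \<Rightarrow> nat \<times> bool) \<Rightarrow> (nat \<Rightarrow> nat \<times> bool) \<Rightarrow> 'u \<Rightarrow> nat) \<Rightarrow> bool"
  where
  "query_scheme m k Nq R A \<longleftrightarrow> (\<forall>n\<in>{1..Nq}.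
     (\<forall>q x r h u. A n q x r h u \<in> {..<m} - ((fst \<circ> r) ` {..<k} \<union> (fst \<circ> h) ` {1..<n})) \<and>
     (\<lambda>(q, x, r, h, u). A n q x r h u) \<in> measurable
        (Pi\<^sub>M {..<m} (\<lambda>_. borel) \<Otimes>\<^sub>M Pi\<^sub>M {..<m} (\<lambda>_. borel) \<Otimes>\<^sub>M
         Pi\<^sub>M {..<k} (\<lambda>_. count_space UNIV) \<Otimes>\<^sub>M Pi\<^sub>M {1..<n} (\<lambda>_. count_space UNIV) \<Otimes>\<^sub>M R)
        (count_space UNIV))"

text \<open>Ordered samples of size \<open>k\<close> from the pool indices, without replacement.\<close>

definition samples_without_replacement :: "nat \<Rightarrow> nat \<Rightarrow> nat list set" where
  "samples_without_replacement m k = {js. length js = k \<and> distinct js \<and> set js \<subseteq> {..<m}}"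

definition class_prior :: "(nat \<Rightarrow> bool) \<Rightarrow> nat \<Rightarrow> bool \<Rightarrow> real" where
  "class_prior z n c =
     (let p1 = (\<Sum>j = 1..n. of_bool (z j)) / real n in if c then p1 else 1 - p1)"

text \<open>The statistic \<open>W\<^sub>n\<close> takes values in \<open>[0, \<infinity>]\<close>. Every numerator is positive, since the label
  \<open>z i\<close> occurs in the sample, so a factor with \<open>Q i (z i) (s i) = 0\<close> is \<open>\<infinity>\<close> and makes the product \<open>\<infinity>\<close>.
  Division on the reals would turn it into \<open>0\<close>, hence into a rejection.\<close>

definition test_statistic ::
    "(nat \<Rightarrow> bool \<Rightarrow> 's \<Rightarrow> real) \<Rightarrow> (nat \<Rightarrow> 's) \<Rightarrow> (nat \<Rightarrow> bool) \<Rightarrow> nat \<Rightarrow> ennreal" where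
  "test_statistic Q s z n =
     (\<Prod>i = 1..n. ennreal (class_prior z n (z i)) / ennreal (Q i (z i) (s i)))"

end

theory Submission imports Defs begin

text \<open>
  The empirical class prior maximizes the likelihood of the observed labels, so
  \<open>1 / W\<^sub>n\<close> is at most \<open>\<Prod>i\<le>n. Q\<^sub>i(Z\<^sub>i | S\<^sub>i) / P(Z\<^sub>i)\<close>. Under the null hypothesis the latent labels of the pool are
  i.i.d. and independent of the features, of the initialization sample and of the seed. With these
  three fixed, every query reads a fresh coordinate of an i.i.d. label vector, chosen from the
  coordinates read before; the likelihood ratio is then a nonnegative supermartingale
  started at \<open>1\<close>, and Ville's inequality bounds the probability that it ever reaches \<open>1 / \<alpha>\<close>.
  There are finitely many label vectors, so conditioning on features and randomization amounts to
  a finite sum over them.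
\<close>

subsection \<open>Ville's inequality for adaptive reading of i.i.d. coordinates\<close>

text \<open>The product is the capital of a gambler who starts with \<open>v\<close> and bets on
  each coordinate as it is read; by \<open>fair\<close> no bet gains on average. The value of the
  first coordinate turns the rest into a shorter game with a new starting capital, which is why the
  induction on \<open>N\<close> generalizes \<open>T\<close>, \<open>idx\<close>, \<open>r\<close>
  and \<open>v\<close>. A bound without division also covers \<open>c = \<infinity>\<close>.\<close>

lemma adaptive_ville:
  fixes w :: "'b pmf" and idx :: "nat \<Rightarrow> ('j \<Rightarrow> 'b) \<Rightarrow> 'j" and r :: "nat \<Rightarrow> ('j \<Rightarrow> 'b) \<Rightarrow> 'b \<Rightarrow> ennreal"
  assumes "finite T"
    and idx: "\<And>n y. n < N \<Longrightarrow> idx n y \<in> T - (\<lambda>i. idx i y) ` {..<n}"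
    and idx_adapted: "\<And>n y y'. n < N \<Longrightarrow> (\<And>i. i < n \<Longrightarrow> y (idx i y) = y' (idx i y)) \<Longrightarrow> idx n y = idx n y'"
    and r_adapted: "\<And>n y y'. n < N \<Longrightarrow> (\<And>i. i < n \<Longrightarrow> y (idx i y) = y' (idx i y)) \<Longrightarrow> r n y = r n y'"
    and fair: "\<And>n y. n < N \<Longrightarrow> (\<integral>\<^sup>+ b. r n y b \<partial>w) \<le> 1"
  shows "c * emeasure (Pi_pmf T d (\<lambda>_. w)) {y. \<exists>n\<le>N. c \<le> v * (\<Prod>i<n. r i y (y (idx i y)))} \<le> v"
  using assms
proof (induction N arbitrary: T idx r v)
  case 0
  \<comment> \<open>Only \<open>n = 0\<close> is left, with the empty product: the event is
    everything if \<open>c \<le> v\<close> and empty otherwise.\<close>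
  show ?case
    using measure_pmf.emeasure_le_1[of "Pi_pmf T d (\<lambda>_. w)" UNIV] by (cases "c \<le> v") auto
next
  case (Suc N)
  note prems = Suc.prems
  show ?case
  proof (cases "c \<le> v")
    case True
    have "c * emeasure (Pi_pmf T d (\<lambda>_. w)) {y. \<exists>n\<le>Suc N. c \<le> v * (\<Prod>i<n. r i y (y (idx i y)))} \<le> c * 1"
      by (intro mult_left_mono measure_pmf.emeasure_le_1) auto
    with True show ?thesis by simp
  next
    case False
    \<comment> \<open>Before anything is read the choice cannot depend on the vector, so the first
      coordinate \<open>j\<close> and the first ratio \<open>r0\<close> are constants;
      \<open>\<lambda>_. d\<close> is just a point at which to evaluate them.\<close>
    define j where "j = idx 0 (\<lambda>_. d)"
    have idx0: "idx 0 y = j" for y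
      unfolding j_def by (rule prems(3)) auto
    define r0 where "r0 = r 0 (\<lambda>_. d)"
    have r0: "r 0 y = r0" for y
      unfolding r0_def by (rule prems(4)) auto
    have j: "j \<in> T" using prems(2)[of 0] idx0 by auto
    define T' where "T' = T - {j}"
    have T: "T = insert j T'" "finite T'" "j \<notin> T'" using j prems(1) by (auto simp: T'_def)
    define E where "E = {y. \<exists>n\<le>Suc N. c \<le> v * (\<Prod>i<n. r i y (y (idx i y)))}"
    \<comment> \<open>Once \<open>b\<close> is found at \<open>j\<close>, the game from its second
      step on is a game on \<open>T'\<close>: times move by one, and \<open>y(j := b)\<close> puts
      the known value back in.\<close>
    define idx' where "idx' b n y = idx (Suc n) (y(j := b))" for b n y
    define r' where "r' b n y = r (Suc n) (y(j := b))" for b n y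
    define E' where "E' b = {y. \<exists>n\<le>N. c \<le> v * r0 b * (\<Prod>i<n. r' b i y (y (idx' b i y)))}" for b
    have idx': "idx' b n y \<in> T' - (\<lambda>i. idx' b i y) ` {..<n}" if "n < N" for n b y
    proof -
      have "idx (Suc n) (y(j := b)) \<in> T - (\<lambda>i. idx i (y(j := b))) ` {..<Suc n}"
        using prems(2) that by auto
      moreover have "(\<lambda>i. idx i (y(j := b))) ` {..<Suc n} = insert j ((\<lambda>i. idx' b i y) ` {..<n})"
        by (auto simp: lessThan_Suc_eq_insert_0 image_image idx'_def idx0)
      ultimately show ?thesis by (auto simp: idx'_def T'_def)
    qed
    \<comment> \<open>Vectors that agree on what the shifted game has read agree on what the
      original game has read: at time 0 both show \<open>b\<close>, and later times are those of the
      shifted game.\<close>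
    have agree: "(y(j := b)) (idx i (y(j := b))) = (y'(j := b)) (idx i (y(j := b)))"
      if "n < N" "\<And>i. i < n \<Longrightarrow> y (idx' b i y) = y' (idx' b i y)" "i < Suc n" for y y' b n i
      using that(2)[of "i - 1"] that(1,3) by (cases i) (auto simp: idx0 idx'_def)
    have E': "y(j := b) \<in> E \<longleftrightarrow> y \<in> E' b" for y b
    proof -
      have *: "(\<Prod>i<Suc n. r i (y(j := b)) ((y(j := b)) (idx i (y(j := b))))) =
        r0 b * (\<Prod>i<n. r' b i y (y (idx' b i y)))" if "n \<le> N" for n
      proof -
        have "(\<Prod>i<n. r (Suc i) (y(j := b)) ((y(j := b)) (idx (Suc i) (y(j := b))))) =
          (\<Prod>i<n. r' b i y (y (idx' b i y)))"
        proof (rule prod.cong)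
          fix i assume "i \<in> {..<n}"
          \<comment> \<open>Coordinate \<open>j\<close> is never read again, so overwriting it
            leaves later readings unchanged.\<close>
          then have "idx' b i y \<noteq> j" using idx'[of i b y] that T(3) by auto
          then show "r (Suc i) (y(j := b)) ((y(j := b)) (idx (Suc i) (y(j := b)))) = r' b i y (y (idx' b i y))"
            by (auto simp: idx'_def r'_def)
        qed simp
        then show ?thesis
          by (simp only: prod.lessThan_Suc_shift idx0 r0 fun_upd_same)
      qed
      have "y(j := b) \<in> E \<longleftrightarrow>
        (\<exists>n\<le>N. c \<le> v * (\<Prod>i<Suc n. r i (y(j := b)) ((y(j := b)) (idx i (y(j := b))))))"
        unfolding E_def mem_Collect_eq
      proof (safe, goal_cases)
        case (1 n)
        \<comment> \<open>As \<open>v < c\<close>, the level is not reached at time 0, so a crossing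
          time has a predecessor.\<close>
        with False have "n \<noteq> 0" by (intro notI) auto
        with 1 show ?case by (intro exI[of _ "n - 1"]) auto
      qed auto
      also have "\<dots> \<longleftrightarrow> y \<in> E' b"
        by (simp only: * E'_def mem_Collect_eq mult.assoc cong: conj_cong)
      finally show ?thesis .
    qed
    \<comment> \<open>Conditioning on coordinate \<open>j\<close>: the product law is the mixture
      over \<open>b\<close> of the law on \<open>T'\<close> with \<open>b\<close> put at
      \<open>j\<close>.\<close>
    have "emeasure (Pi_pmf T d (\<lambda>_. w)) E =
      (\<integral>\<^sup>+ b. emeasure (Pi_pmf T' d (\<lambda>_. w)) (E' b) \<partial>w)"
    proof -
      have "(\<lambda>y. y(j := b)) -` E = E' b" for b using E' by auto
      then show ?thesis
      unfolding T(1) Pi_pmf_insert'[OF T(2,3)]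
        by (simp add: emeasure_bind_pmf flip: map_pmf_def)
    qed
    then have "c * emeasure (Pi_pmf T d (\<lambda>_. w)) E =
      (\<integral>\<^sup>+ b. c * emeasure (Pi_pmf T' d (\<lambda>_. w)) (E' b) \<partial>w)"
      by (simp add: nn_integral_cmult)
    \<comment> \<open>Induction hypothesis for each \<open>b\<close>, with starting capital
      \<open>v * r0 b\<close>; averaging over \<open>b\<close> then uses \<open>fair\<close> at time
      0.\<close>
    also have "\<dots> \<le> (\<integral>\<^sup>+ b. v * r0 b \<partial>w)"
      unfolding E'_def
    proof (intro nn_integral_mono Suc.IH)
      fix b n y y' assume *: "n < N" "\<And>i. i < n \<Longrightarrow> y (idx' b i y) = y' (idx' b i y)"
      show "idx' b n y = idx' b n y'" "r' b n y = r' b n y'"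
        unfolding idx'_def r'_def using *(1)
        by (intro prems(3,4) agree[where n=n and y=y and y'=y' and b=b, OF *]; simp)+
    next
      fix b n y assume "n < N"
      then show "integral\<^sup>N (measure_pmf w) (r' b n y) \<le> 1"
        unfolding r'_def by (intro prems(5)) auto
    qed (use T(2) idx' in auto)
    also have "\<dots> \<le> v * 1"
      using prems(5)[of 0 "\<lambda>_. d"] by (simp add: nn_integral_cmult r0_def mult_left_le)
    finally show ?thesis by (simp add: E_def)
  qed
qed

subsection \<open>Likelihood bound for the test statistic\<close>

lemma pmf_bool_sum: "pmf w True + pmf w False = 1"
  using sum_pmf_eq_1[OF finite subset_UNIV, of w] by (simp add: UNIV_bool add.commute)

lemma class_prior_pos:
  assumes "i \<in> {1..n}"
  shows "0 < class_prior z n (z i)"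
proof -
  let ?a = "\<Sum>j = 1..n. of_bool (z j) :: real"
  have "?a = real (card {j \<in> {1..n}. z j})"
    by (simp add: of_bool_def sum.If_cases Int_def)
  moreover have "real n - ?a = (\<Sum>j = 1..n. of_bool (\<not> z j) :: real)"
    by (simp add: of_bool_not_iff sum_subtractf)
  then have "real n - ?a = real (card {j \<in> {1..n}. \<not> z j})"
    by (simp add: of_bool_def sum.If_cases Int_def)
  ultimately show ?thesis
    using assms by (auto simp: class_prior_def Let_def field_simps card_gt_0_iff)
qed

text \<open>Maximum likelihood: among Bernoulli laws the empirical frequencies give the observed
  sequence the largest probability. The ratios of the factors have mean at most 1 over the sample,
  and \<open>x \<le> exp (x - 1)\<close> carries this over to their product.\<close>

lemma prod_pmf_le_prod_class_prior:
  fixes w :: "bool pmf"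
  shows "(\<Prod>i = 1..n. pmf w (z i)) \<le> (\<Prod>i = 1..n. class_prior z n (z i))"
proof (cases "n = 0")
  case False
  let ?a = "\<Sum>j = 1..n. of_bool (z j) :: real"
  define f where "f c = pmf w c / class_prior z n c" for c
  have pos: "0 < class_prior z n (z i)" if "i \<in> {1..n}" for i
    using that by (rule class_prior_pos)
  have "(\<Sum>i = 1..n. f (z i)) = (\<Sum>i = 1..n. of_bool (z i) * f True + (1 - of_bool (z i)) * f False)"
    by (intro sum.cong) auto
  also have "\<dots> = ?a * f True + (real n - ?a) * f False"
    by (simp add: sum.distrib sum_distrib_right[symmetric] sum_subtractf)
  \<comment> \<open>A label that occurs is counted \<open>n\<close> times its class prior, which
    cancels the denominator of \<open>f\<close>. A label absent from the sample contributes 0, hence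
    only an inequality.\<close>
  also have "?a * f True \<le> n * pmf w True"
    by (cases "?a = 0") (use False in \<open>auto simp: f_def class_prior_def Let_def\<close>)
  also have "(real n - ?a) * f False \<le> n * pmf w False"
  proof (cases "?a = n")
    case neq: False
    have "class_prior z n False = (real n - ?a) / n"
      using False by (simp add: class_prior_def diff_divide_distrib)
    with neq show ?thesis by (simp add: f_def)
  qed simp
  also have "n * pmf w True + n * pmf w False = n"
    using pmf_bool_sum[of w] by (simp flip: distrib_left)
  finally have sum: "(\<Sum>i = 1..n. f (z i)) \<le> n" by simp
  have "(\<Prod>i = 1..n. f (z i)) \<le> (\<Prod>i = 1..n. exp (f (z i) - 1))"
    using pos by (intro prod_mono) (auto simp: f_def less_imp_le intro: exp_ge_add_one_self[of "f _ - 1", simplified] divide_nonneg_pos)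
  also have "\<dots> = exp ((\<Sum>i = 1..n. f (z i)) - n)"
    by (simp add: exp_sum[symmetric] sum_subtractf)
  also have "\<dots> \<le> 1" using sum by simp
  finally have "(\<Prod>i = 1..n. f (z i)) \<le> 1" .
  moreover have "0 < (\<Prod>i = 1..n. class_prior z n (z i))"
    using pos by (intro prod_pos) auto
  ultimately show ?thesis
    by (simp add: f_def prod_dividef divide_le_eq_1_pos)
qed simp

lemma ennreal_inverse_antimono: "a \<le> b \<Longrightarrow> inverse b \<le> inverse (a :: ennreal)"
  including ennreal.lifting
  by transfer (rule ereal_inverse_antimono)

lemma ennreal_divide_prod: "(\<And>i. i \<in> A \<Longrightarrow> 0 \<le> f i) \<Longrightarrow> (\<And>i. i \<in> A \<Longrightarrow> 0 < g i) \<Longrightarrow>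
  (\<Prod>i\<in>A. ennreal (f i) / ennreal (g i)) = ennreal ((\<Prod>i\<in>A. f i) / (\<Prod>i\<in>A. g i))"
  by (simp add: divide_ennreal prod_ennreal less_imp_le flip: prod_dividef)

lemma prod_ennreal_eq_top:
  fixes f :: "_ \<Rightarrow> ennreal"
  assumes "finite A" "i \<in> A" "f i = top" "\<And>j. j \<in> A \<Longrightarrow> f j \<noteq> 0"
  shows "prod f A = top"
  using assms by (auto simp: ennreal_prod_eq_top)

text \<open>The prior maximizes the likelihood, so replacing it by the true label law
  \<open>w\<close> can only increase the inverse statistic. Each factor on the right is fixed once
  its label is read, whereas the factors of \<open>test_statistic\<close> are recomputed for every
  \<open>n\<close>; this is what makes the right-hand side fit for Ville's inequality.\<close>

lemma inverse_test_statistic_le: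
  fixes w :: "bool pmf"
  assumes Q: "\<And>i c s. i \<in> {1..n} \<Longrightarrow> 0 \<le> Q i c s"
  shows "inverse (test_statistic Q s z n) \<le> (\<Prod>i = 1..n. ennreal (Q i (z i) (s i)) / ennreal (pmf w (z i)))"
proof (cases "\<exists>i\<in>{1..n}. Q i (z i) (s i) = 0")
  case True
  then obtain i where "i \<in> {1..n}" "Q i (z i) (s i) = 0" by blast
  \<comment> \<open>A zero prediction makes the statistic infinite, so its inverse is 0.\<close>
  then have "test_statistic Q s z n = top"
    unfolding test_statistic_def using class_prior_pos[of _ n z]
    by (intro prod_ennreal_eq_top[of _ i])
      (auto simp: ennreal_divide_eq_0_iff ennreal_divide_eq_top_iff ennreal_eq_0_iff not_le)
  then show ?thesis by simp
next
  case False
  then have Q_pos: "0 < Q i (z i) (s i)" if "i \<in> {1..n}" for i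
    using that Q[OF that, of "z i" "s i"] by (metis less_eq_real_def)
  show ?thesis
  proof (cases "\<exists>i\<in>{1..n}. pmf w (z i) = 0")
    case True
    then obtain i where "i \<in> {1..n}" "pmf w (z i) = 0" by blast
    \<comment> \<open>A label impossible under \<open>w\<close> makes the right-hand side infinite:
      all predictions are positive here, so no factor is 0 and \<open>0 * \<infinity> = 0\<close>
      does not interfere.\<close>
    then have "(\<Prod>i = 1..n. ennreal (Q i (z i) (s i)) / ennreal (pmf w (z i))) = top"
      using Q_pos
      by (intro prod_ennreal_eq_top[of _ i])
        (auto simp: ennreal_divide_eq_0_iff ennreal_divide_eq_top_iff ennreal_eq_0_iff not_le)
    then show ?thesis by simp
  next
    case False
    then have w_pos: "0 < pmf w (z i)" if "i \<in> {1..n}" for i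
      using that by (metis pmf_pos)
    have "0 < (\<Prod>i = 1..n. class_prior z n (z i)) / (\<Prod>i = 1..n. Q i (z i) (s i))"
      using Q_pos class_prior_pos[of _ n z] by (intro divide_pos_pos prod_pos) auto
    then have "inverse (test_statistic Q s z n) =
      ennreal ((\<Prod>i = 1..n. Q i (z i) (s i)) / (\<Prod>i = 1..n. class_prior z n (z i)))"
      unfolding test_statistic_def using Q_pos class_prior_pos[of _ n z]
      by (subst ennreal_divide_prod) (auto simp: inverse_ennreal less_imp_le)
    also have "\<dots> \<le> ennreal ((\<Prod>i = 1..n. Q i (z i) (s i)) / (\<Prod>i = 1..n. pmf w (z i)))"
      using Q_pos class_prior_pos[of _ n z] w_pos prod_pmf_le_prod_class_prior[of w z n]
      by (intro ennreal_leI divide_left_mono) (auto intro!: prod_nonneg prod_pos mult_pos_pos less_imp_le)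
    also have "\<dots> = (\<Prod>i = 1..n. ennreal (Q i (z i) (s i)) / ennreal (pmf w (z i)))"
      using Q_pos w_pos by (subst ennreal_divide_prod) (auto simp: less_imp_le)
    finally show ?thesis .
  qed
qed

subsection \<open>Independence of labels from features and randomization\<close>

text \<open>Each pair has a product law and the pairs are independent, so the label vector is
  independent of the feature vector. Both sides are finite measures in \<open>C\<close>, hence it
  suffices to compare them on boxes.\<close>

lemma (in prob_space) emeasure_labels_features:
  fixes X :: "'i \<Rightarrow> 'a \<Rightarrow> 'x" and Y :: "'i \<Rightarrow> 'a \<Rightarrow> 'y" and \<eta> :: "'i \<Rightarrow> 'y"
  assumes I: "finite I" "I \<noteq> {}"
    and indep: "indep_vars (\<lambda>_. S \<Otimes>\<^sub>M count_space UNIV) (\<lambda>i \<omega>. (X i \<omega>, Y i \<omega>)) I"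
    and "prob_space P1" and "prob_space P2" and sets: "sets P1 = sets S" "sets P2 = UNIV"
    and law: "\<And>i. i \<in> I \<Longrightarrow> distr M (S \<Otimes>\<^sub>M count_space UNIV) (\<lambda>\<omega>. (X i \<omega>, Y i \<omega>)) = P1 \<Otimes>\<^sub>M P2"
    and C: "C \<in> sets (Pi\<^sub>M I (\<lambda>_. S))"
  shows "emeasure M {\<omega> \<in> space M. (\<forall>i\<in>I. Y i \<omega> = \<eta> i) \<and> (\<lambda>i\<in>I. X i \<omega>) \<in> C} =
    (\<Prod>i\<in>I. emeasure P2 {\<eta> i}) * emeasure M {\<omega> \<in> space M. (\<lambda>i\<in>I. X i \<omega>) \<in> C}"
proof -
  interpret P1: prob_space P1 by fact
  interpret P2: prob_space P2 by fact
  define V where "V \<omega> = (\<lambda>i\<in>I. X i \<omega>)" for \<omega>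
  define G where "G = {\<omega> \<in> space M. \<forall>i\<in>I. Y i \<omega> = \<eta> i}"
  have XY: "(\<lambda>\<omega>. (X i \<omega>, Y i \<omega>)) \<in> M \<rightarrow>\<^sub>M S \<Otimes>\<^sub>M count_space UNIV" if "i \<in> I" for i
    using indep that by (auto simp: indep_vars_def)
  have X: "X i \<in> M \<rightarrow>\<^sub>M S" and Y: "Y i \<in> M \<rightarrow>\<^sub>M count_space UNIV" if "i \<in> I" for i
    using measurable_compose[OF XY[OF that] measurable_fst] measurable_compose[OF XY[OF that] measurable_snd] by simp_all
  have V [measurable]: "V \<in> M \<rightarrow>\<^sub>M Pi\<^sub>M I (\<lambda>_. S)"
    unfolding V_def using X by (intro measurable_restrict) auto
  have "{\<omega> \<in> space M. Y i \<omega> = \<eta> i} \<in> sets M" if "i \<in> I" for i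
    using measurable_sets[OF Y[OF that], of "{\<eta> i}"] by (simp add: vimage_def Int_def conj_commute)
  then have G [measurable]: "G \<in> sets M"
    unfolding G_def using I by (intro sets.sets_Collect_finite_All')
  \<comment> \<open>Independence over \<open>i\<close>, then the product law inside each pair. A
    general \<open>H\<close> serves twice: singletons \<open>{\<eta> i}\<close> fix the labels, and
    \<open>UNIV\<close> recovers the law of the features alone.\<close>
  have rect: "emeasure M {\<omega> \<in> space M. \<forall>i\<in>I. X i \<omega> \<in> A i \<and> Y i \<omega> \<in> H i} =
      (\<Prod>i\<in>I. emeasure P1 (A i) * emeasure P2 (H i))"
    if A: "\<And>i. i \<in> I \<Longrightarrow> A i \<in> sets S" for A H
  proof -
    have meas: "A i \<times> H i \<in> sets (S \<Otimes>\<^sub>M count_space UNIV)" if "i \<in> I" for i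
      using A[OF that] by (intro pair_measureI) auto
    have "prob (\<Inter>i\<in>I. (\<lambda>\<omega>. (X i \<omega>, Y i \<omega>)) -` (A i \<times> H i) \<inter> space M) =
      (\<Prod>i\<in>I. prob ((\<lambda>\<omega>. (X i \<omega>, Y i \<omega>)) -` (A i \<times> H i) \<inter> space M))"
      using meas by (intro indep_varsD_finite[OF indep I(2,1)])
    then have "emeasure M (\<Inter>i\<in>I. (\<lambda>\<omega>. (X i \<omega>, Y i \<omega>)) -` (A i \<times> H i) \<inter> space M) =
      (\<Prod>i\<in>I. emeasure M ((\<lambda>\<omega>. (X i \<omega>, Y i \<omega>)) -` (A i \<times> H i) \<inter> space M))"
      by (simp add: emeasure_eq_measure prod_ennreal)
    also have "\<dots> = (\<Prod>i\<in>I. emeasure P1 (A i) * emeasure P2 (H i))"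
    proof (rule prod.cong)
      fix i assume i: "i \<in> I"
      have "emeasure M ((\<lambda>\<omega>. (X i \<omega>, Y i \<omega>)) -` (A i \<times> H i) \<inter> space M) = emeasure (P1 \<Otimes>\<^sub>M P2) (A i \<times> H i)"
        using i by (simp add: emeasure_distr[OF XY meas] flip: law)
      also have "\<dots> = emeasure P1 (A i) * emeasure P2 (H i)"
        using A[OF i] by (intro P2.emeasure_pair_measure_Times) (auto simp: sets)
      finally show "emeasure M ((\<lambda>\<omega>. (X i \<omega>, Y i \<omega>)) -` (A i \<times> H i) \<inter> space M) =
        emeasure P1 (A i) * emeasure P2 (H i)" .
    qed simp
    also have "(\<Inter>i\<in>I. (\<lambda>\<omega>. (X i \<omega>, Y i \<omega>)) -` (A i \<times> H i) \<inter> space M) =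
      {\<omega> \<in> space M. \<forall>i\<in>I. X i \<omega> \<in> A i \<and> Y i \<omega> \<in> H i}"
      using I by auto
    finally show ?thesis .
  qed
  define c where "c = (\<Prod>i\<in>I. emeasure P2 {\<eta> i})"
  \<comment> \<open>\<open>density M (indicator G)\<close> restricts \<open>M\<close> to the event
    that the labels are \<open>\<eta>\<close>, so that the left-hand side becomes an image measure
    evaluated at \<open>C\<close>.\<close>
  have "distr (density M (indicator G)) (Pi\<^sub>M I (\<lambda>_. S)) V = scale_measure c (distr M (Pi\<^sub>M I (\<lambda>_. S)) V)"
  proof (rule measure_eqI_PiM_finite[OF I(1)])
    have em: "emeasure (distr (density M (indicator G)) (Pi\<^sub>M I (\<lambda>_. S)) V) C =
       emeasure M (G \<inter> (V -` C \<inter> space M))" if [measurable]: "C \<in> sets (Pi\<^sub>M I (\<lambda>_. S))" for C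
      by (simp add: emeasure_distr emeasure_density indicator_inter_arith[symmetric])
    {
      fix A :: "'i \<Rightarrow> 'x set" assume A: "\<And>i. i \<in> I \<Longrightarrow> A i \<in> sets S"
      then have [measurable]: "Pi\<^sub>E I A \<in> sets (Pi\<^sub>M I (\<lambda>_. S))"
        using I by (intro sets_PiM_I_finite) auto
      have "emeasure (distr (density M (indicator G)) (Pi\<^sub>M I (\<lambda>_. S)) V) (Pi\<^sub>E I A) =
        emeasure M {\<omega> \<in> space M. \<forall>i\<in>I. X i \<omega> \<in> A i \<and> Y i \<omega> \<in> {\<eta> i}}"
        by (simp add: em) (auto simp: G_def V_def PiE_iff intro!: arg_cong[of _ _ "emeasure M"])
      also have "\<dots> = c * (\<Prod>i\<in>I. emeasure P1 (A i))"
        using A by (simp only: rect) (simp add: c_def prod.distrib mult.commute)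
      also have "(\<Prod>i\<in>I. emeasure P1 (A i)) = emeasure M {\<omega> \<in> space M. \<forall>i\<in>I. X i \<omega> \<in> A i \<and> Y i \<omega> \<in> UNIV}"
        using A P2.emeasure_space_1 sets_eq_imp_space_eq[of P2 "count_space UNIV"]
        by (simp only: rect) (simp add: sets)
      also have "{\<omega> \<in> space M. \<forall>i\<in>I. X i \<omega> \<in> A i \<and> Y i \<omega> \<in> UNIV} = V -` Pi\<^sub>E I A \<inter> space M"
        by (auto simp: V_def PiE_iff)
      also have "c * emeasure M \<dots> = emeasure (scale_measure c (distr M (Pi\<^sub>M I (\<lambda>_. S)) V)) (Pi\<^sub>E I A)"
        by (simp add: emeasure_distr)
      finally show "emeasure (distr (density M (indicator G)) (Pi\<^sub>M I (\<lambda>_. S)) V) (Pi\<^sub>E I A) =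
        emeasure (scale_measure c (distr M (Pi\<^sub>M I (\<lambda>_. S)) V)) (Pi\<^sub>E I A)" .
    }
    show "range (\<lambda>_::nat. Pi\<^sub>E I (\<lambda>_. space S)) \<subseteq> prod_algebra I (\<lambda>_. S)"
      using I by (auto intro!: prod_algebraI_finite)
    show "emeasure (distr (density M (indicator G)) (Pi\<^sub>M I (\<lambda>_. S)) V) (Pi\<^sub>E I (\<lambda>_. space S)) \<noteq> \<infinity>"
      using I by (subst em) (auto intro!: sets_PiM_I_finite)
  qed (auto simp: space_PiM)
  then have "emeasure (distr (density M (indicator G)) (Pi\<^sub>M I (\<lambda>_. S)) V) C =
    emeasure (scale_measure c (distr M (Pi\<^sub>M I (\<lambda>_. S)) V)) C" by simp
  then have "emeasure M (G \<inter> (V -` C \<inter> space M)) = c * emeasure M (V -` C \<inter> space M)"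
    using C by (simp add: emeasure_distr emeasure_density indicator_inter_arith[symmetric])
  moreover have "G \<inter> (V -` C \<inter> space M) = {\<omega> \<in> space M. (\<forall>i\<in>I. Y i \<omega> = \<eta> i) \<and> (\<lambda>i\<in>I. X i \<omega>) \<in> C}"
    "V -` C \<inter> space M = {\<omega> \<in> space M. (\<lambda>i\<in>I. X i \<omega>) \<in> C}"
    by (auto simp: G_def V_def)
  ultimately show ?thesis by (simp add: c_def)
qed

text \<open>Queries depend jointly on features, initialization sample and seed, so the labels must
  be independent of all three together. As \<open>T\<close> is independent of the whole pool,
  \<open>emeasure_labels_features\<close> settles the rectangles \<open>C \<times> D\<close>, which
  generate the product.\<close>

lemma (in prob_space) emeasure_labels_features_randomization:
  fixes X :: "'i \<Rightarrow> 'a \<Rightarrow> 'x" and Y :: "'i \<Rightarrow> 'a \<Rightarrow> 'y" and \<eta> :: "'i \<Rightarrow> 'y"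
  assumes I: "finite I" "I \<noteq> {}"
    and indep: "indep_vars (\<lambda>_. S \<Otimes>\<^sub>M count_space UNIV) (\<lambda>i \<omega>. (X i \<omega>, Y i \<omega>)) I"
    and prob: "prob_space P1" "prob_space P2" and sets: "sets P1 = sets S" "sets P2 = UNIV"
    and law: "\<And>i. i \<in> I \<Longrightarrow> distr M (S \<Otimes>\<^sub>M count_space UNIV) (\<lambda>\<omega>. (X i \<omega>, Y i \<omega>)) = P1 \<Otimes>\<^sub>M P2"
    and T [measurable]: "T \<in> M \<rightarrow>\<^sub>M N"
    and randomization: "indep_set
      (sets (vimage_algebra (space M) (\<lambda>\<omega>. \<lambda>i\<in>I. (X i \<omega>, Y i \<omega>)) (Pi\<^sub>M I (\<lambda>_. S \<Otimes>\<^sub>M count_space UNIV))))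
      (sets (vimage_algebra (space M) T N))"
    and B: "B \<in> sets (Pi\<^sub>M I (\<lambda>_. S) \<Otimes>\<^sub>M N)"
  shows "emeasure M {\<omega> \<in> space M. (\<forall>i\<in>I. Y i \<omega> = \<eta> i) \<and> (\<lambda>i\<in>I. X i \<omega>, T \<omega>) \<in> B} =
    (\<Prod>i\<in>I. emeasure P2 {\<eta> i}) * emeasure M {\<omega> \<in> space M. (\<lambda>i\<in>I. X i \<omega>, T \<omega>) \<in> B}"
proof -
  let ?V = "\<lambda>\<omega>. \<lambda>i\<in>I. X i \<omega>"
  let ?G = "{\<omega> \<in> space M. \<forall>i\<in>I. Y i \<omega> = \<eta> i}"
  let ?P = "Pi\<^sub>M I (\<lambda>_. S \<Otimes>\<^sub>M count_space (UNIV :: 'y set))"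
  let ?F = "Pi\<^sub>M I (\<lambda>_. S)"
  define c where "c = (\<Prod>i\<in>I. emeasure P2 {\<eta> i})"
  have XY: "(\<lambda>\<omega>. (X i \<omega>, Y i \<omega>)) \<in> M \<rightarrow>\<^sub>M S \<Otimes>\<^sub>M count_space UNIV" if "i \<in> I" for i
    using indep that by (auto simp: indep_vars_def)
  have pool: "(\<lambda>\<omega>. \<lambda>i\<in>I. (X i \<omega>, Y i \<omega>)) \<in> M \<rightarrow>\<^sub>M ?P"
    using XY by (intro measurable_restrict) auto
  have V [measurable]: "?V \<in> M \<rightarrow>\<^sub>M ?F"
    using measurable_compose[OF XY measurable_fst] by (intro measurable_restrict) auto
  have "{\<omega> \<in> space M. Y i \<omega> = \<eta> i} \<in> sets M" if "i \<in> I" for i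
    using measurable_sets[OF measurable_compose[OF XY[OF that] measurable_snd], of "{\<eta> i}"]
    by (simp add: vimage_def Int_def conj_commute)
  then have G [measurable]: "?G \<in> sets M"
    using I by (intro sets.sets_Collect_finite_All')
  have indep_T: "emeasure M {\<omega> \<in> space M. (\<forall>i\<in>I. Y i \<omega> \<in> H i) \<and> ?V \<omega> \<in> C \<and> T \<omega> \<in> D} =
      emeasure M {\<omega> \<in> space M. (\<forall>i\<in>I. Y i \<omega> \<in> H i) \<and> ?V \<omega> \<in> C} * emeasure M {\<omega> \<in> space M. T \<omega> \<in> D}"
    if [measurable]: "C \<in> sets ?F" and D: "D \<in> sets N" for C D H
  proof -
    \<comment> \<open>\<open>randomization\<close> speaks of events generated by the pool vector;
      \<open>?K\<close> is the set of pool vectors whose preimage is the event on labels and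
      features.\<close>
    let ?K = "{f \<in> space ?P. (\<forall>i\<in>I. snd (f i) \<in> H i) \<and> (\<lambda>i\<in>I. fst (f i)) \<in> C}"
    have snd_meas: "(\<lambda>f. snd (f i)) \<in> ?P \<rightarrow>\<^sub>M count_space UNIV" if "i \<in> I" for i
      using measurable_compose[OF measurable_component_singleton[OF that] measurable_snd] .
    have "{f \<in> space ?P. \<forall>i\<in>I. snd (f i) \<in> H i} \<in> sets ?P"
    proof (intro sets.sets_Collect_finite_All' I)
      show "{f \<in> space ?P. snd (f i) \<in> H i} \<in> sets ?P" if "i \<in> I" for i
        using measurable_sets[OF snd_meas[OF that], of "H i"] by (simp add: vimage_def Int_def conj_commute)
    qed
    moreover have fst_meas: "(\<lambda>f. \<lambda>i\<in>I. fst (f i)) \<in> ?P \<rightarrow>\<^sub>M ?F"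
    proof (rule measurable_restrict)
      show "(\<lambda>f. fst (f i)) \<in> ?P \<rightarrow>\<^sub>M S" if "i \<in> I" for i
        using measurable_compose[OF measurable_component_singleton[OF that] measurable_fst] .
    qed
    have "{f \<in> space ?P. (\<lambda>i\<in>I. fst (f i)) \<in> C} \<in> sets ?P"
      using measurable_sets[OF fst_meas that(1)] by (simp add: vimage_def Int_def conj_commute)
    ultimately have K: "?K \<in> sets ?P"
      by (intro sets.sets_Collect_conj)
    have eqs: "(\<lambda>\<omega>. \<lambda>i\<in>I. (X i \<omega>, Y i \<omega>)) -` ?K \<inter> space M =
        {\<omega> \<in> space M. (\<forall>i\<in>I. Y i \<omega> \<in> H i) \<and> ?V \<omega> \<in> C}"
      "T -` D \<inter> space M = {\<omega> \<in> space M. T \<omega> \<in> D}"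
      using measurable_space[OF pool] by (auto cong: restrict_cong)
    have "prob ({\<omega> \<in> space M. (\<forall>i\<in>I. Y i \<omega> \<in> H i) \<and> ?V \<omega> \<in> C} \<inter> {\<omega> \<in> space M. T \<omega> \<in> D}) =
      prob {\<omega> \<in> space M. (\<forall>i\<in>I. Y i \<omega> \<in> H i) \<and> ?V \<omega> \<in> C} * prob {\<omega> \<in> space M. T \<omega> \<in> D}"
      using in_vimage_algebra[OF K, of "\<lambda>\<omega>. \<lambda>i\<in>I. (X i \<omega>, Y i \<omega>)" "space M"]
        in_vimage_algebra[OF D, of T "space M"]
      unfolding eqs by (rule indep_setD[OF randomization])
    moreover have "{\<omega> \<in> space M. (\<forall>i\<in>I. Y i \<omega> \<in> H i) \<and> ?V \<omega> \<in> C} \<inter> {\<omega> \<in> space M. T \<omega> \<in> D} =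
      {\<omega> \<in> space M. (\<forall>i\<in>I. Y i \<omega> \<in> H i) \<and> ?V \<omega> \<in> C \<and> T \<omega> \<in> D}"
      by auto
    ultimately show ?thesis
      by (simp add: emeasure_eq_measure ennreal_mult)
  qed
  have VT [measurable]: "(\<lambda>\<omega>. (?V \<omega>, T \<omega>)) \<in> M \<rightarrow>\<^sub>M ?F \<Otimes>\<^sub>M N"
    by measurable
  let ?\<mu> = "distr (density M (indicator ?G)) (?F \<Otimes>\<^sub>M N) (\<lambda>\<omega>. (?V \<omega>, T \<omega>))"
  let ?\<nu> = "scale_measure c (distr M (?F \<Otimes>\<^sub>M N) (\<lambda>\<omega>. (?V \<omega>, T \<omega>)))"
  have \<mu>: "emeasure ?\<mu> B = emeasure M {\<omega> \<in> space M. (\<forall>i\<in>I. Y i \<omega> = \<eta> i) \<and> (?V \<omega>, T \<omega>) \<in> B}"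
    if [measurable]: "B \<in> sets (?F \<Otimes>\<^sub>M N)" for B
    by (simp add: emeasure_distr emeasure_density indicator_inter_arith[symmetric])
      (auto intro!: arg_cong[of _ _ "emeasure M"])
  have \<nu>: "emeasure ?\<nu> B = c * emeasure M {\<omega> \<in> space M. (?V \<omega>, T \<omega>) \<in> B}"
    if [measurable]: "B \<in> sets (?F \<Otimes>\<^sub>M N)" for B
    by (simp add: emeasure_distr vimage_def Int_def conj_commute)
  have "?\<mu> = ?\<nu>"
  proof (rule measure_eqI_generator_eq[OF Int_stable_pair_measure_generator pair_measure_closed])
    fix E assume "E \<in> {a \<times> b |a b. a \<in> sets ?F \<and> b \<in> sets N}"
    then obtain C D where E: "E = C \<times> D" and C [measurable]: "C \<in> sets ?F" and D [measurable]: "D \<in> sets N"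
      by auto
    have "emeasure ?\<mu> E = emeasure M {\<omega> \<in> space M. (\<forall>i\<in>I. Y i \<omega> \<in> {\<eta> i}) \<and> ?V \<omega> \<in> C \<and> T \<omega> \<in> D}"
      by (subst \<mu>) (auto simp: E)
    also have "\<dots> = c * (emeasure M {\<omega> \<in> space M. ?V \<omega> \<in> C} * emeasure M {\<omega> \<in> space M. T \<omega> \<in> D})"
      unfolding indep_T[OF C D]
      using emeasure_labels_features[OF I indep prob sets law C, of \<eta>] by (simp add: c_def mult.assoc)
    also have "emeasure M {\<omega> \<in> space M. ?V \<omega> \<in> C} * emeasure M {\<omega> \<in> space M. T \<omega> \<in> D} =
      emeasure M {\<omega> \<in> space M. ?V \<omega> \<in> C \<and> T \<omega> \<in> D}"
      using indep_T[OF C D, of "\<lambda>_. UNIV"] by simp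
    also have "c * \<dots> = emeasure ?\<nu> E"
      by (subst \<nu>) (auto simp: E)
    finally show "emeasure ?\<mu> E = emeasure ?\<nu> E" .
  next
    show "range (\<lambda>_::nat. space ?F \<times> space N) \<subseteq> {a \<times> b |a b. a \<in> sets ?F \<and> b \<in> sets N}"
      by auto
    show "emeasure ?\<mu> (space ?F \<times> space N) \<noteq> \<infinity>"
      by (subst \<mu>) auto
  qed (auto simp: sets_pair_measure)
  then show ?thesis
    using \<mu>[OF B] \<nu>[OF B] by (simp add: c_def)
qed

text \<open>A probability measure on \<open>bool\<close> is a Bernoulli pmf; with the label marginal
  as a pmf \<open>w\<close>, the label vector follows a \<open>Pi_pmf\<close> and
  \<open>adaptive_ville\<close> applies.\<close>

lemma null_hypothesis_product:
  assumes "null_hypothesis p" "prob_space p" "sets p = sets pair_space"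
  obtains P w where "prob_space P" "sets P = sets borel" "p = P \<Otimes>\<^sub>M measure_pmf w"
proof -
  interpret prob_space p by fact
  let ?P2 = "distr p (count_space UNIV) snd"
  have [measurable]: "fst \<in> p \<rightarrow>\<^sub>M borel" "snd \<in> p \<rightarrow>\<^sub>M count_space UNIV"
    using assms(3) by (simp_all cong: measurable_cong_sets)
  interpret P2: prob_space ?P2 by (rule prob_space_distr) measurable
  define w where "w = bernoulli_pmf (measure ?P2 {True})"
  have "- {True} = {False}" by auto
  then have F: "measure ?P2 {False} = 1 - measure ?P2 {True}"
    using P2.prob_compl[of "{True}"] by (simp add: Compl_eq_Diff_UNIV)
  have "?P2 = measure_pmf w"
  proof (rule measure_eqI_finite[of _ UNIV])
    fix b show "emeasure ?P2 {b} = emeasure (measure_pmf w) {b}"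
      using F by (cases b) (auto simp: P2.emeasure_eq_measure emeasure_pmf_single w_def)
  qed auto
  then show thesis
    using assms(1) by (intro that[of "distr p borel fst" w] prob_space_distr) (auto simp: null_hypothesis_def)
qed

subsection \<open>The query process\<close>

locale active_querying =
  fixes m k Nq :: nat and R :: "'u measure"
    and L :: "nat \<Rightarrow> (nat \<Rightarrow> (real ^ 'd) \<times> bool) \<Rightarrow> (nat \<Rightarrow> (real ^ 'd) \<times> bool) \<Rightarrow> bool \<Rightarrow> real ^ 'd \<Rightarrow> real"
    and A :: "nat \<Rightarrow> (nat \<Rightarrow> real) \<Rightarrow> (nat \<Rightarrow> real ^ 'd) \<Rightarrow> (nat \<Rightarrow> nat \<times> bool) \<Rightarrow> (nat \<Rightarrow> nat \<times> bool) \<Rightarrow> 'u \<Rightarrow> nat"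
  assumes learning: "learning_rule k Nq L"
    and querying: "query_scheme m k Nq R A"
begin

text \<open>The queries as a deterministic function of features, sample, seed and a hypothetical
  label vector, so that labels can vary while the rest is fixed. The whole path is carried along
  because \<open>L\<close> and \<open>A\<close> look at all earlier queries; entry 0 is a dummy, as
  queries are numbered from 1.\<close>

primrec query_path :: "(nat \<Rightarrow> real ^ 'd) \<Rightarrow> nat list \<Rightarrow> 'u \<Rightarrow> (nat \<Rightarrow> bool) \<Rightarrow> nat \<Rightarrow> nat \<Rightarrow> nat" where
  "query_path x js u y 0 = (\<lambda>_. 0)"
| "query_path x js u y (Suc n) = (query_path x js u y n)(Suc n :=
     A (Suc n)
       (\<lambda>j\<in>{..<m}. L (Suc n) (observed {..<k} x y ((!) js)) (observed {1..<Suc n} x y (query_path x js u y n)) True (x j))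
       x (observed {..<k} id y ((!) js)) (observed {1..<Suc n} id y (query_path x js u y n)) u)"

definition queried :: "(nat \<Rightarrow> real ^ 'd) \<Rightarrow> nat list \<Rightarrow> 'u \<Rightarrow> (nat \<Rightarrow> bool) \<Rightarrow> nat \<Rightarrow> nat" where
  "queried x js u y n = query_path x js u y n n"

definition learned :: "(nat \<Rightarrow> real ^ 'd) \<Rightarrow> nat list \<Rightarrow> 'u \<Rightarrow> (nat \<Rightarrow> bool) \<Rightarrow> nat \<Rightarrow> bool \<Rightarrow> real ^ 'd \<Rightarrow> real" where
  "learned x js u y n = L n (observed {..<k} x y ((!) js)) (observed {1..<n} x y (queried x js u y))"

lemma query_path_eq_queried: "i \<le> n \<Longrightarrow> query_path x js u y n i = queried x js u y i"
  by (induction n) (auto simp: queried_def le_Suc_eq)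

lemma observed_cong:
  assumes "\<And>i. i \<in> T \<Longrightarrow> y (idx i) = y' (idx' i)" "\<And>i. i \<in> T \<Longrightarrow> x (idx i) = x' (idx' i)"
  shows "observed T x y idx = observed T x' y' idx'"
  using assms by (auto simp: observed_def restrict_def)

lemma observed_query_path:
  "observed {1..<Suc l} x' y (query_path x js u y l) = observed {1..<Suc l} x' y (queried x js u y)"
  by (rule observed_cong) (simp_all add: query_path_eq_queried)

lemma queried_rec:
  assumes "n \<ge> 1"
  shows "queried x js u y n = A n (\<lambda>j\<in>{..<m}. learned x js u y n True (x j)) x
    (observed {..<k} id y ((!) js)) (observed {1..<n} id y (queried x js u y)) u"
proof -
  obtain l where n: "n = Suc l" using assms by (cases n) auto
  show ?thesis
    by (simp add: n queried_def[of _ _ _ _ "Suc l"] learned_def observed_query_path del: One_nat_def)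
qed

text \<open>Labels enter only through the two records, which hold labels of the sample and of
  earlier queries. This is the adaptedness that \<open>adaptive_ville\<close> asks for.\<close>

lemma queried_adapted:
  assumes "\<And>i. i < k \<Longrightarrow> y (js ! i) = y' (js ! i)" "n \<ge> 1"
    "\<And>i. i \<in> {1..<n} \<Longrightarrow> y (queried x js u y i) = y' (queried x js u y i)"
  shows "queried x js u y n = queried x js u y' n" "learned x js u y n = learned x js u y' n"
proof -
  have "queried x js u y n = queried x js u y' n \<and> learned x js u y n = learned x js u y' n"
    using assms(2,3)
  proof (induction n rule: less_induct)
    case (less n)
    \<comment> \<open>Both label vectors lead to the same earlier queries, so the records
      coincide.\<close>
    have eq: "queried x js u y i = queried x js u y' i" if "i \<in> {1..<n}" for i
      using that less.prems by (intro less.IH[THEN conjunct1]) auto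
    have obs: "observed {1..<n} x y (queried x js u y) = observed {1..<n} x y' (queried x js u y')"
      "observed {1..<n} id y (queried x js u y) = observed {1..<n} id y' (queried x js u y')"
      "observed {..<k} x y ((!) js) = observed {..<k} x y' ((!) js)"
      "observed {..<k} id y ((!) js) = observed {..<k} id y' ((!) js)"
      using eq less.prems assms(1) by (auto intro!: observed_cong simp del: One_nat_def)
    have learned: "learned x js u y n = learned x js u y' n"
      by (simp add: learned_def obs del: One_nat_def)
    then show ?case
      using less.prems(1) by (simp add: queried_rec obs del: One_nat_def)
  qed
  then show "queried x js u y n = queried x js u y' n" "learned x js u y n = learned x js u y' n"
    by auto
qed

lemma queried_fresh:
  assumes "n \<in> {1..Nq}"
  shows "queried x js u y n \<in> {..<m} - ((\<lambda>i. js ! i) ` {..<k} \<union> queried x js u y ` {1..<n})"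
proof -
  let ?r = "observed {..<k} id y ((!) js)" and ?h = "observed {1..<n} id y (queried x js u y)"
  have "A n q x ?r ?h u \<in> {..<m} - ((fst \<circ> ?r) ` {..<k} \<union> (fst \<circ> ?h) ` {1..<n})" for q
    using querying assms unfolding query_scheme_def by blast
  \<comment> \<open>Records made with \<open>id\<close> store the indices themselves, so their first
    components are the indices already labeled.\<close>
  moreover have "(fst \<circ> ?r) ` {..<k} = (\<lambda>i. js ! i) ` {..<k}" "(fst \<circ> ?h) ` {1..<n} = queried x js u y ` {1..<n}"
    by (auto simp: observed_def image_iff)
  ultimately show ?thesis
    using assms by (subst queried_rec) auto
qed

lemma learned_predictor: "n \<in> {1..Nq} \<Longrightarrow> class_prob_predictor (learned x js u y n)"
  using learning by (auto simp: learning_rule_def learned_def)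

text \<open>The betting ratio of query \<open>n\<close> on label \<open>c\<close>: predicted over
  true probability, a bet that gains nothing on average under \<open>w\<close>.\<close>

definition gain :: "bool pmf \<Rightarrow> (nat \<Rightarrow> real ^ 'd) \<Rightarrow> nat list \<Rightarrow> 'u \<Rightarrow> (nat \<Rightarrow> bool) \<Rightarrow> nat \<Rightarrow> bool \<Rightarrow> ennreal" where
  "gain w x js u y n c = ennreal (learned x js u y n c (x (queried x js u y n))) / ennreal (pmf w c)"

text \<open>The initialization is treated as \<open>k\<close> further queries on which nothing is staked.\<close>

lemma ville_queried:
  assumes js: "js \<in> samples_without_replacement m k"
  shows "c * emeasure (Pi_pmf {..<m} d (\<lambda>_. w))
    {y. \<exists>n\<in>{1..Nq}. c \<le> (\<Prod>i = 1..n. gain w x js u y i (y (queried x js u y i)))} \<le> 1"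
proof -
  \<comment> \<open>Combined clock: times below \<open>k\<close> read the sample, and time
    \<open>k + i\<close> carries query \<open>i + 1\<close>. Ratio 1 in the first phase leaves the
    capital alone.\<close>
  define idx where "idx n y = (if n < k then js ! n else queried x js u y (Suc (n - k)))" for n y
  define r where "r n y b = (if n < k then 1 else gain w x js u y (Suc (n - k)) b)" for n y b
  have js': "length js = k" "distinct js" "set js \<subseteq> {..<m}"
    using js by (auto simp: samples_without_replacement_def)
  \<comment> \<open>Translation from the combined clock: query \<open>i\<close> takes place at time
    \<open>i + k - 1\<close>.\<close>
  have agree: "(\<forall>i<k. y (js ! i) = y' (js ! i)) \<and>
      (\<forall>i\<in>{1..<Suc (n - k)}. y (queried x js u y i) = y' (queried x js u y i))"
    if "n \<ge> k" "\<And>i. i < n \<Longrightarrow> y (idx i y) = y' (idx i y)" for n y y'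
  proof (intro conjI allI ballI impI)
    fix i assume "i < k"
    with that(1) that(2)[of i] show "y (js ! i) = y' (js ! i)" by (simp add: idx_def)
  next
    fix i assume i: "i \<in> {1..<Suc (n - k)}"
    then have "i + k - 1 < n" "\<not> i + k - 1 < k" "Suc (i + k - 1 - k) = i"
      using that(1) by auto
    with that(2)[of "i + k - 1"] show "y (queried x js u y i) = y' (queried x js u y i)"
      by (simp only: idx_def if_False)
  qed
  have idx_adapted: "idx n y = idx n y'" if "\<And>i. i < n \<Longrightarrow> y (idx i y) = y' (idx i y)" for n y y'
    unfolding idx_def using agree[of n y y', OF _ that] by (auto intro: queried_adapted)
  have ville: "c * emeasure (Pi_pmf {..<m} d (\<lambda>_. w)) {y. \<exists>n\<le>k + Nq. c \<le> 1 * (\<Prod>i<n. r i y (y (idx i y)))} \<le> 1"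
  proof (rule adaptive_ville)
    fix n y assume n: "n < k + Nq"
    show "idx n y \<in> {..<m} - (\<lambda>i. idx i y) ` {..<n}"
    proof (cases "n < k")
      case True
      then have "js ! n \<in> {..<m}" using js' by (metis nth_mem subsetD)
      moreover have "js ! n \<noteq> js ! i" if "i < n" for i
        using True that js' by (simp add: nth_eq_iff_index_eq)
      ultimately show ?thesis using True by (auto simp: idx_def)
    next
      case False
      then have fresh: "idx n y \<in> {..<m} - ((\<lambda>i. js ! i) ` {..<k} \<union> queried x js u y ` {1..<Suc (n - k)})"
        using queried_fresh[of "Suc (n - k)" x js u y] n by (auto simp: idx_def)
      have "(\<lambda>i. idx i y) ` {..<n} \<subseteq> (\<lambda>i. js ! i) ` {..<k} \<union> queried x js u y ` {1..<Suc (n - k)}"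
        using False by (auto simp: idx_def)
      with fresh show ?thesis by blast
    qed
    show "(\<integral>\<^sup>+ b. r n y b \<partial>w) \<le> 1"
    proof (cases "n < k")
      case False
      define q where "q b = learned x js u y (Suc (n - k)) b (x (queried x js u y (Suc (n - k))))" for b
      have "class_prob_predictor (learned x js u y (Suc (n - k)))"
        using n False by (intro learned_predictor) auto
      then have q: "q False + q True = 1" "0 \<le> q b" for b
        by (auto simp: class_prob_predictor_def q_def)
      have "(\<integral>\<^sup>+ b. r n y b \<partial>w) = (\<Sum>b\<in>UNIV. ennreal (pmf w b) * (ennreal (q b) / ennreal (pmf w b)))"
        using False by (subst nn_integral_measure_pmf_support[of UNIV])
         (auto simp: r_def gain_def q_def mult.commute)
      \<comment> \<open>Equality can fail only at a label with \<open>pmf w b = 0\<close>, where the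
        product is 0 while \<open>q b\<close> may be positive.\<close>
      also have "\<dots> \<le> (\<Sum>b\<in>UNIV. ennreal (q b))"
      proof (intro sum_mono)
        fix b show "ennreal (pmf w b) * (ennreal (q b) / ennreal (pmf w b)) \<le> ennreal (q b)"
          by (cases "pmf w b = 0")
            (auto simp: divide_ennreal q(2) pmf_pos simp flip: ennreal_mult)
      qed
      also have "\<dots> = ennreal 1"
        using q by (simp add: UNIV_bool add.commute flip: ennreal_plus)
      finally show ?thesis by simp
    qed (simp add: r_def)
  next
    fix n y y' assume "n < k + Nq" "\<And>i. i < n \<Longrightarrow> y (idx i y) = y' (idx i y)"
    note * = this(2)
    show "idx n y = idx n y'" using * by (intro idx_adapted)
    show "r n y = r n y'"
    proof (cases "n < k")
      case False
      then have "queried x js u y (Suc (n - k)) = queried x js u y' (Suc (n - k))"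
        "learned x js u y (Suc (n - k)) = learned x js u y' (Suc (n - k))"
        using agree[of n y y', OF _ *] by (auto intro!: queried_adapted)
      then show ?thesis by (simp add: r_def gain_def fun_eq_iff)
    qed (simp add: r_def fun_eq_iff)
  qed simp
  have prod: "(\<Prod>i<k + n. r i y (y (idx i y))) = (\<Prod>i = 1..n. gain w x js u y i (y (queried x js u y i)))" for n y
  proof -
    have "(\<Prod>i<k + n. r i y (y (idx i y))) = (\<Prod>i<k. r i y (y (idx i y))) * (\<Prod>i<n. r (k + i) y (y (idx (k + i) y)))"
      by (induction n) (auto simp: mult_ac)
    also have "\<dots> = (\<Prod>i<n. gain w x js u y (Suc i) (y (queried x js u y (Suc i))))"
      by (simp add: r_def idx_def)
    also have "\<dots> = (\<Prod>i = 1..n. gain w x js u y i (y (queried x js u y i)))"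
      by (simp add: prod.atLeast1_atMost_eq)
    finally show ?thesis .
  qed
  \<comment> \<open>After query \<open>n\<close> the combined clock stands at \<open>k + n\<close>,
    where the product is that of the gains.\<close>
  have "{y. \<exists>n\<in>{1..Nq}. c \<le> (\<Prod>i = 1..n. gain w x js u y i (y (queried x js u y i)))}
    \<subseteq> {y. \<exists>n\<le>k + Nq. c \<le> 1 * (\<Prod>i<n. r i y (y (idx i y)))}"
    using prod by (auto simp del: One_nat_def intro: exI[of _ "k + _"])
  then show ?thesis
    by (intro order_trans[OF mult_left_mono[OF emeasure_mono] ville]) auto
qed

section \<open>Measurability of the query process for a fixed label vector\<close>

context
  fixes S :: "'s measure" and x :: "'s \<Rightarrow> nat \<Rightarrow> real ^ 'd" and js :: "'s \<Rightarrow> nat list" and u :: "'s \<Rightarrow> 'u"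
  assumes x [measurable]: "x \<in> S \<rightarrow>\<^sub>M Pi\<^sub>M {..<m} (\<lambda>_. borel)"
    and js [measurable]: "js \<in> S \<rightarrow>\<^sub>M count_space UNIV"
    and u [measurable]: "u \<in> S \<rightarrow>\<^sub>M R"
begin

text \<open>There are countably many indices, and outside the pool extensionality makes the value
  the constant \<open>undefined\<close>.\<close>

lemma measurable_feature:
  assumes "g \<in> S \<rightarrow>\<^sub>M count_space UNIV"
  shows "(\<lambda>s. x s (g s)) \<in> borel_measurable S"
proof (rule measurable_compose_countable[OF _ assms])
  show "(\<lambda>s. x s i) \<in> borel_measurable S" for i
  proof (cases "i < m")
    case False
    then have "x s i = undefined" if "s \<in> space S" for s
      using measurable_space[OF x that] by (auto simp: space_PiM PiE_def extensional_def)
    then show ?thesis by (subst measurable_cong[where g = "\<lambda>_. undefined"]) auto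
  qed measurable
qed

lemma measurable_observed:
  assumes g: "\<And>i. i \<in> T \<Longrightarrow> (\<lambda>s. g s i) \<in> S \<rightarrow>\<^sub>M count_space UNIV"
  shows "(\<lambda>s. observed T (x s) y (g s)) \<in> S \<rightarrow>\<^sub>M Pi\<^sub>M T (\<lambda>_. pair_space)"
    and "(\<lambda>s. observed T id y (g s)) \<in> S \<rightarrow>\<^sub>M Pi\<^sub>M T (\<lambda>_. count_space UNIV)"
  unfolding observed_def
  by (intro measurable_restrict measurable_Pair measurable_feature g
        measurable_compose[OF g, of _ y] measurable_compose[OF g, of _ "\<lambda>a. (id a, y a)"]; simp)+

lemma measurable_init: "(\<lambda>s. js s ! i) \<in> S \<rightarrow>\<^sub>M count_space UNIV"
  by measurable

text \<open>Measurability is assumed of earlier queries only, so that the lemma can be used inside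
  the induction for \<open>measurable_queried\<close>.\<close>

lemma measurable_learned:
  assumes "n \<in> {1..Nq}" "\<xi> \<in> borel_measurable S"
    and "\<And>i. i \<in> {1..<n} \<Longrightarrow> (\<lambda>s. queried (x s) (js s) (u s) y i) \<in> S \<rightarrow>\<^sub>M count_space UNIV"
  shows "(\<lambda>s. learned (x s) (js s) (u s) y n c (\<xi> s)) \<in> borel_measurable S"
proof -
  have L: "(\<lambda>(d, h, s). L n d h c s) \<in> borel_measurable
      (Pi\<^sub>M {..<k} (\<lambda>_. pair_space) \<Otimes>\<^sub>M Pi\<^sub>M {1..<n} (\<lambda>_. pair_space) \<Otimes>\<^sub>M borel)"
    using learning assms(1) unfolding learning_rule_def by blast
  have "(\<lambda>s. (observed {..<k} (x s) y ((!) (js s)), observed {1..<n} (x s) y (queried (x s) (js s) (u s) y), \<xi> s))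
    \<in> S \<rightarrow>\<^sub>M Pi\<^sub>M {..<k} (\<lambda>_. pair_space) \<Otimes>\<^sub>M Pi\<^sub>M {1..<n} (\<lambda>_. pair_space) \<Otimes>\<^sub>M borel"
    by (intro measurable_Pair measurable_observed measurable_init assms(2,3))
  from measurable_compose[OF this L] show ?thesis
    by (simp add: learned_def)
qed

lemma measurable_queried:
  "n \<in> {1..Nq} \<Longrightarrow> (\<lambda>s. queried (x s) (js s) (u s) y n) \<in> S \<rightarrow>\<^sub>M count_space UNIV"
proof (induction n rule: less_induct)
  case (less n)
  then have IH: "(\<lambda>s. queried (x s) (js s) (u s) y i) \<in> S \<rightarrow>\<^sub>M count_space UNIV" if "i \<in> {1..<n}" for i
    using that by auto
  have A: "(\<lambda>(q, x, r, h, u). A n q x r h u) \<in> measurable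
        (Pi\<^sub>M {..<m} (\<lambda>_. borel) \<Otimes>\<^sub>M Pi\<^sub>M {..<m} (\<lambda>_. borel) \<Otimes>\<^sub>M
         Pi\<^sub>M {..<k} (\<lambda>_. count_space UNIV) \<Otimes>\<^sub>M Pi\<^sub>M {1..<n} (\<lambda>_. count_space UNIV) \<Otimes>\<^sub>M R)
        (count_space UNIV)"
    using querying less.prems unfolding query_scheme_def by blast
  have "(\<lambda>s. (\<lambda>j\<in>{..<m}. learned (x s) (js s) (u s) y n True (x s j), x s, observed {..<k} id y ((!) (js s)),
      observed {1..<n} id y (queried (x s) (js s) (u s) y), u s)) \<in> S \<rightarrow>\<^sub>M
        (Pi\<^sub>M {..<m} (\<lambda>_. borel) \<Otimes>\<^sub>M Pi\<^sub>M {..<m} (\<lambda>_. borel) \<Otimes>\<^sub>M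
         Pi\<^sub>M {..<k} (\<lambda>_. count_space UNIV) \<Otimes>\<^sub>M Pi\<^sub>M {1..<n} (\<lambda>_. count_space UNIV) \<Otimes>\<^sub>M R)"
    by (intro measurable_Pair measurable_observed measurable_init IH x u measurable_restrict
        measurable_learned measurable_feature less.prems) auto
  from measurable_compose[OF this A] show ?case
    using less.prems by (simp add: queried_rec del: One_nat_def)
qed

lemma measurable_gain:
  assumes "n \<in> {1..Nq}"
  shows "(\<lambda>s. gain w (x s) (js s) (u s) y n (y (queried (x s) (js s) (u s) y n))) \<in> borel_measurable S"
proof -
  have q: "(\<lambda>s. queried (x s) (js s) (u s) y i) \<in> S \<rightarrow>\<^sub>M count_space UNIV" if "i \<in> {1..n}" for i
    using that assms by (intro measurable_queried) auto
  have "(\<lambda>s. gain w (x s) (js s) (u s) y n c) \<in> borel_measurable S" for c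
    unfolding gain_def
    by (intro borel_measurable_divide_ennreal measurable_compose[OF _ measurable_ennreal] measurable_const
      measurable_learned assms measurable_feature q) (use assms in auto)
  then show ?thesis
    by (rule measurable_compose_countable) (intro measurable_compose[OF q, of _ y]; use assms in simp)
qed

end

end

subsection \<open>Anytime validity\<close>

theorem theorem5p1:
  fixes M :: "'w measure" and p :: "((real ^ 'd) \<times> bool) measure" and R :: "'u measure"
    and m k Nq :: nat and \<alpha> :: real
    and X :: "nat \<Rightarrow> 'w \<Rightarrow> real ^ 'd" and Y :: "nat \<Rightarrow> 'w \<Rightarrow> bool"
    and J :: "'w \<Rightarrow> nat list" and U :: "'w \<Rightarrow> 'u"
    and L :: "nat \<Rightarrow> (nat \<Rightarrow> (real ^ 'd) \<times> bool) \<Rightarrow> (nat \<Rightarrow> (real ^ 'd) \<times> bool) \<Rightarrow> bool \<Rightarrow> real ^ 'd \<Rightarrow> real"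
    and A :: "nat \<Rightarrow> (nat \<Rightarrow> real) \<Rightarrow> (nat \<Rightarrow> real ^ 'd) \<Rightarrow> (nat \<Rightarrow> nat \<times> bool) \<Rightarrow> (nat \<Rightarrow> nat \<times> bool) \<Rightarrow> 'u \<Rightarrow> nat"
    and Q :: "nat \<Rightarrow> 'w \<Rightarrow> bool \<Rightarrow> real ^ 'd \<Rightarrow> real"
    and I :: "nat \<Rightarrow> 'w \<Rightarrow> nat" and S :: "nat \<Rightarrow> 'w \<Rightarrow> real ^ 'd" and Z :: "nat \<Rightarrow> 'w \<Rightarrow> bool"
  assumes "prob_space M"
    and "prob_space p" and "sets p = sets pair_space"
    and H0: "null_hypothesis p"
    and level: "\<alpha> \<in> {0..1}"
    and budget: "k + Nq \<le> m"
    and pool_iid: "prob_space.indep_vars M (\<lambda>_. pair_space) (\<lambda>j \<omega>. (X j \<omega>, Y j \<omega>)) {..<m}"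
    and pool_law: "\<And>j. j < m \<Longrightarrow> distr M pair_space (\<lambda>\<omega>. (X j \<omega>, Y j \<omega>)) = p"
    and init_sample: "\<And>\<omega>. \<omega> \<in> space M \<Longrightarrow> J \<omega> \<in> samples_without_replacement m k"
    and init_uniform: "distr M (count_space UNIV) J
                         = measure_pmf (pmf_of_set (samples_without_replacement m k))"
    and seed: "U \<in> measurable M R"
    and randomization_indep: "prob_space.indep_set M
          (sets (vimage_algebra (space M) (\<lambda>\<omega>. \<lambda>j\<in>{..<m}. (X j \<omega>, Y j \<omega>)) (Pi\<^sub>M {..<m} (\<lambda>_. pair_space))))
          (sets (vimage_algebra (space M) (\<lambda>\<omega>. (J \<omega>, U \<omega>)) (count_space UNIV \<Otimes>\<^sub>M R)))"
    and learning: "learning_rule k Nq L"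
    and querying: "query_scheme m k Nq R A"
    and predictor: "\<And>n \<omega>. n \<in> {1..Nq} \<Longrightarrow> \<omega> \<in> space M \<Longrightarrow>
          Q n \<omega> = L n (observed {..<k} (\<lambda>j. X j \<omega>) (\<lambda>j. Y j \<omega>) (\<lambda>i. J \<omega> ! i))
                      (observed {1..<n} (\<lambda>j. X j \<omega>) (\<lambda>j. Y j \<omega>) (\<lambda>i. I i \<omega>))"
    and query: "\<And>n \<omega>. n \<in> {1..Nq} \<Longrightarrow> \<omega> \<in> space M \<Longrightarrow>
          I n \<omega> = A n (\<lambda>j\<in>{..<m}. Q n \<omega> True (X j \<omega>)) (\<lambda>j\<in>{..<m}. X j \<omega>)
                      (observed {..<k} id (\<lambda>j. Y j \<omega>) (\<lambda>i. J \<omega> ! i))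
                      (observed {1..<n} id (\<lambda>j. Y j \<omega>) (\<lambda>i. I i \<omega>)) (U \<omega>)"
    and queried_feature: "\<And>n \<omega>. n \<in> {1..Nq} \<Longrightarrow> \<omega> \<in> space M \<Longrightarrow> S n \<omega> = X (I n \<omega>) \<omega>"
    and oracle_label: "\<And>n \<omega>. n \<in> {1..Nq} \<Longrightarrow> \<omega> \<in> space M \<Longrightarrow> Z n \<omega> = Y (I n \<omega>) \<omega>"
  shows "\<P>(\<omega> in M. \<exists>n\<in>{1..Nq}.
           test_statistic (\<lambda>i. Q i \<omega>) (\<lambda>i. S i \<omega>) (\<lambda>i. Z i \<omega>) n \<le> ennreal \<alpha>) \<le> \<alpha>"
proof (cases "Nq = 0")
  case True
  then show ?thesis using level by simp
next
  case False
  interpret prob_space M by fact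
  interpret active_querying m k Nq R L A
    by unfold_locales (fact learning querying)+
  obtain P w where P: "prob_space P" "sets P = sets borel" and p: "p = P \<Otimes>\<^sub>M measure_pmf w"
    using null_hypothesis_product[OF H0 assms(2,3)] .
  let ?V = "\<lambda>\<omega>. \<lambda>j\<in>{..<m}. X j \<omega>"
  let ?T = "\<lambda>\<omega>. (J \<omega>, U \<omega>)"
  let ?N = "count_space UNIV \<Otimes>\<^sub>M R"
  let ?S = "Pi\<^sub>M {..<m} (\<lambda>_. borel :: (real ^ 'd) measure) \<Otimes>\<^sub>M ?N"
  \<comment> \<open>The pool labels continued by \<open>False\<close>, the default value of
    \<open>Pi_pmf {..<m} False\<close>; thus \<open>y \<omega>\<close> lies in the finite set
    \<open>H\<close> below.\<close>
  define y where "y \<omega> = (\<lambda>j. if j < m then Y j \<omega> else False)" for \<omega>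
  have y: "y \<omega> j = Y j \<omega>" if "j < m" for j \<omega>
    using that by (simp add: y_def)
  define c where "c = inverse (ennreal \<alpha>)"
  \<comment> \<open>Features, sample and seed for which the label vector \<open>\<eta>\<close> would
    drive the likelihood ratio up to \<open>c\<close>, which is \<infinity> when
    \<open>\<alpha> = 0\<close>.\<close>
  define E where "E \<eta> = {s \<in> space ?S. \<exists>n\<in>{1..Nq}. c \<le> (\<Prod>i = 1..n.
      gain w (fst s) (fst (snd s)) (snd (snd s)) \<eta> i (\<eta> (queried (fst s) (fst (snd s)) (snd (snd s)) \<eta> i)))}" for \<eta>
  define H where "H = PiE_dflt {..<m} False (\<lambda>_. UNIV :: bool set)"
  have "finite H" by (auto simp: H_def)

  have T [measurable]: "?T \<in> M \<rightarrow>\<^sub>M ?N"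
  proof (rule measurableI)
    show "?T \<omega> \<in> space ?N" if "\<omega> \<in> space M" for \<omega>
      using measurable_space[OF seed that] by (simp add: space_pair_measure)
    \<comment> \<open>The independence assumption already contains that the sets generated by sample
      and seed are events.\<close>
    show "?T -` D \<inter> space M \<in> sets M" if "D \<in> sets ?N" for D
      using in_vimage_algebra[OF that] indep_setD_ev2[OF randomization_indep] by blast
  qed
  have V [measurable]: "?V \<in> M \<rightarrow>\<^sub>M Pi\<^sub>M {..<m} (\<lambda>_. borel)"
  proof (rule measurable_restrict)
    fix j assume "j \<in> {..<m}"
    then have "(\<lambda>\<omega>. (X j \<omega>, Y j \<omega>)) \<in> M \<rightarrow>\<^sub>M pair_space"
      using pool_iid by (auto simp: indep_vars_def)
    from measurable_compose[OF this measurable_fst] show "X j \<in> borel_measurable M" by simp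
  qed
  have E [measurable]: "E \<eta> \<in> sets ?S" for \<eta>
  proof -
    have [measurable]: "(\<lambda>s. gain w (fst s) (fst (snd s)) (snd (snd s)) \<eta> i
        (\<eta> (queried (fst s) (fst (snd s)) (snd (snd s)) \<eta> i))) \<in> borel_measurable ?S" if "i \<in> {1..Nq}" for i
      using that by (intro measurable_gain) measurable
    have "{s \<in> space ?S. c \<le> (\<Prod>i = 1..n. gain w (fst s) (fst (snd s)) (snd (snd s)) \<eta> i
        (\<eta> (queried (fst s) (fst (snd s)) (snd (snd s)) \<eta> i)))} \<in> sets ?S" if "n \<in> {1..Nq}" for n
      using that by (intro borel_measurable_le borel_measurable_const borel_measurable_prod_ennreal) auto
    then show ?thesis unfolding E_def by (intro sets.sets_Collect_finite_Ex) auto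
  qed

  \<comment> \<open>The given process is the deterministic one at the actual labels. Passing from
    \<open>X\<close> and \<open>Y\<close> to \<open>?V\<close> and \<open>y\<close> is harmless
    because all labeled indices are below \<open>m\<close>.\<close>
  have process: "I n \<omega> = queried (?V \<omega>) (J \<omega>) (U \<omega>) (y \<omega>) n \<and> Q n \<omega> = learned (?V \<omega>) (J \<omega>) (U \<omega>) (y \<omega>) n"
    if "\<omega> \<in> space M" "n \<in> {1..Nq}" for n \<omega>
    using that(2)
  proof (induction n rule: less_induct)
    case (less n)
    have IH: "I i \<omega> = queried (?V \<omega>) (J \<omega>) (U \<omega>) (y \<omega>) i" "queried (?V \<omega>) (J \<omega>) (U \<omega>) (y \<omega>) i < m"
      if "i \<in> {1..<n}" for i
    proof -
      have i: "i < n" "i \<in> {1..Nq}" using that less.prems by auto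
      show "I i \<omega> = queried (?V \<omega>) (J \<omega>) (U \<omega>) (y \<omega>) i"
        using less.IH[OF i] by (rule conjunct1)
      show "queried (?V \<omega>) (J \<omega>) (U \<omega>) (y \<omega>) i < m"
        using queried_fresh[OF i(2)] by blast
    qed
    have J: "J \<omega> ! i < m" if "i < k" for i
    proof -
      have "length (J \<omega>) = k" "set (J \<omega>) \<subseteq> {..<m}"
        using init_sample[OF \<open>\<omega> \<in> space M\<close>] by (auto simp: samples_without_replacement_def)
      with that show ?thesis by (metis lessThan_iff nth_mem subsetD)
    qed
    have obs: "observed {..<k} (\<lambda>j. X j \<omega>) (\<lambda>j. Y j \<omega>) (\<lambda>i. J \<omega> ! i) = observed {..<k} (?V \<omega>) (y \<omega>) ((!) (J \<omega>))"
      "observed {..<k} id (\<lambda>j. Y j \<omega>) (\<lambda>i. J \<omega> ! i) = observed {..<k} id (y \<omega>) ((!) (J \<omega>))"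
      "observed {1..<n} (\<lambda>j. X j \<omega>) (\<lambda>j. Y j \<omega>) (\<lambda>i. I i \<omega>) =
        observed {1..<n} (?V \<omega>) (y \<omega>) (queried (?V \<omega>) (J \<omega>) (U \<omega>) (y \<omega>))"
      "observed {1..<n} id (\<lambda>j. Y j \<omega>) (\<lambda>i. I i \<omega>) =
        observed {1..<n} id (y \<omega>) (queried (?V \<omega>) (J \<omega>) (U \<omega>) (y \<omega>))"
      by (rule observed_cong; simp add: IH J y)+
    have Q: "Q n \<omega> = learned (?V \<omega>) (J \<omega>) (U \<omega>) (y \<omega>) n"
      unfolding predictor[OF less.prems \<open>\<omega> \<in> space M\<close>] learned_def obs ..
    have "n \<ge> 1" using less.prems by simp
    have "(\<lambda>j\<in>{..<m}. learned (?V \<omega>) (J \<omega>) (U \<omega>) (y \<omega>) n True (X j \<omega>)) =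
      (\<lambda>j\<in>{..<m}. learned (?V \<omega>) (J \<omega>) (U \<omega>) (y \<omega>) n True (?V \<omega> j))"
      by (rule restrict_ext) simp
    then have "I n \<omega> = queried (?V \<omega>) (J \<omega>) (U \<omega>) (y \<omega>) n"
      unfolding query[OF less.prems \<open>\<omega> \<in> space M\<close>] queried_rec[OF \<open>n \<ge> 1\<close>] obs Q by simp
    with Q show ?case by blast
  qed

  \<comment> \<open>Rejection forces the likelihood ratio up to the level \<open>c\<close>, by
    \<open>inverse_test_statistic_le\<close>.\<close>
  have reject: "(?V \<omega>, ?T \<omega>) \<in> E (y \<omega>)"
    if \<omega>: "\<omega> \<in> space M" and n: "n \<in> {1..Nq}"
      and W: "test_statistic (\<lambda>i. Q i \<omega>) (\<lambda>i. S i \<omega>) (\<lambda>i. Z i \<omega>) n \<le> ennreal \<alpha>" for \<omega> n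
  proof -
    let ?q = "queried (?V \<omega>) (J \<omega>) (U \<omega>) (y \<omega>)"
    have Q_nonneg: "0 \<le> Q i \<omega> b s" if "i \<in> {1..n}" for i b s
      using process[OF \<omega>, of i] learned_predictor[of i "?V \<omega>" "J \<omega>" "U \<omega>" "y \<omega>"] that n
      by (auto simp: class_prob_predictor_def)
    have gain: "gain w (?V \<omega>) (J \<omega>) (U \<omega>) (y \<omega>) i (y \<omega> (?q i)) =
      ennreal (Q i \<omega> (Z i \<omega>) (S i \<omega>)) / ennreal (pmf w (Z i \<omega>))" if "i \<in> {1..n}" for i
    proof -
      have "i \<in> {1..Nq}" using that n by auto
      moreover from this have "?q i < m" using queried_fresh[of i "?V \<omega>" "J \<omega>" "U \<omega>" "y \<omega>"] by auto
      ultimately show ?thesis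
        using process[OF \<omega>, of i] queried_feature[OF _ \<omega>, of i] oracle_label[OF _ \<omega>, of i]
        by (simp add: gain_def y)
    qed
    have "c \<le> inverse (test_statistic (\<lambda>i. Q i \<omega>) (\<lambda>i. S i \<omega>) (\<lambda>i. Z i \<omega>) n)"
      unfolding c_def using W by (rule ennreal_inverse_antimono)
    also have "\<dots> \<le> (\<Prod>i = 1..n. ennreal (Q i \<omega> (Z i \<omega>) (S i \<omega>)) / ennreal (pmf w (Z i \<omega>)))"
      by (rule inverse_test_statistic_le) (rule Q_nonneg)
    also have "\<dots> = (\<Prod>i = 1..n. gain w (?V \<omega>) (J \<omega>) (U \<omega>) (y \<omega>) i (y \<omega> (?q i)))"
      by (intro prod.cong refl) (simp only: gain)
    finally show ?thesis
      using n measurable_space[OF V \<omega>] measurable_space[OF T \<omega>]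
      by (auto simp: E_def space_pair_measure simp del: One_nat_def)
  qed

  have labels: "emeasure M {\<omega> \<in> space M. (\<forall>j\<in>{..<m}. Y j \<omega> = \<eta> j) \<and> (?V \<omega>, ?T \<omega>) \<in> E \<eta>} =
    ennreal (pmf (Pi_pmf {..<m} False (\<lambda>_. w)) \<eta>) * emeasure M {\<omega> \<in> space M. (?V \<omega>, ?T \<omega>) \<in> E \<eta>}"
    if "\<eta> \<in> H" for \<eta>
  proof -
    \<comment> \<open>A positive \<open>Nq\<close> and the budget condition give a nonempty pool, as
      the independence lemma requires.\<close>
    have "{..<m} \<noteq> {}" using False budget by (auto simp: lessThan_empty_iff)
    then have "emeasure M {\<omega> \<in> space M. (\<forall>j\<in>{..<m}. Y j \<omega> = \<eta> j) \<and> (?V \<omega>, ?T \<omega>) \<in> E \<eta>} =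
      (\<Prod>j<m. emeasure (measure_pmf w) {\<eta> j}) * emeasure M {\<omega> \<in> space M. (?V \<omega>, ?T \<omega>) \<in> E \<eta>}"
      using pool_law p P E[of \<eta>]
      by (intro emeasure_labels_features_randomization[OF _ _ pool_iid P(1) _ P(2) _ _ T randomization_indep])
        (auto intro: measure_pmf.prob_space_axioms)
    also have "(\<Prod>j<m. emeasure (measure_pmf w) {\<eta> j}) = ennreal (pmf (Pi_pmf {..<m} False (\<lambda>_. w)) \<eta>)"
      using that by (subst pmf_Pi') (auto simp: H_def PiE_dflt_def emeasure_pmf_single prod_ennreal)
    finally show ?thesis .
  qed

  \<comment> \<open>Features, sample and seed stay as they are at \<open>\<omega>\<close>, while
    \<open>\<eta>\<close> ranges over all label vectors under the null law: the sum is the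
    probability that Ville's inequality bounds.\<close>
  have level_bound: "(\<Sum>\<eta>\<in>H. ennreal (pmf (Pi_pmf {..<m} False (\<lambda>_. w)) \<eta>) * indicator (E \<eta>) (?V \<omega>, ?T \<omega>)) \<le> ennreal \<alpha>"
    if \<omega>: "\<omega> \<in> space M" for \<omega>
  proof -
    let ?R = "{\<eta>. \<exists>n\<in>{1..Nq}. c \<le> (\<Prod>i = 1..n. gain w (?V \<omega>) (J \<omega>) (U \<omega>) \<eta> i
        (\<eta> (queried (?V \<omega>) (J \<omega>) (U \<omega>) \<eta> i)))}"
    have iff: "(?V \<omega>, ?T \<omega>) \<in> E \<eta> \<longleftrightarrow> \<eta> \<in> ?R" for \<eta>
      using measurable_space[OF V \<omega>] measurable_space[OF T \<omega>]
      by (auto simp: E_def space_pair_measure simp del: One_nat_def)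
    have "(\<Sum>\<eta>\<in>H. ennreal (pmf (Pi_pmf {..<m} False (\<lambda>_. w)) \<eta>) * indicator (E \<eta>) (?V \<omega>, ?T \<omega>)) =
      (\<Sum>\<eta>\<in>H. indicator ?R \<eta> * ennreal (pmf (Pi_pmf {..<m} False (\<lambda>_. w)) \<eta>))"
      by (intro sum.cong refl) (auto simp: indicator_def iff simp del: One_nat_def)
    also have "\<dots> = (\<integral>\<^sup>+ \<eta>. indicator ?R \<eta> \<partial>Pi_pmf {..<m} False (\<lambda>_. w))"
      using set_Pi_pmf_subset[of "{..<m}" False "\<lambda>_. w"]
      by (intro nn_integral_measure_pmf_support[OF \<open>finite H\<close>, symmetric]) (auto simp: H_def PiE_dflt_def)
    also have "\<dots> = emeasure (Pi_pmf {..<m} False (\<lambda>_. w)) ?R"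
      by (subst nn_integral_indicator) auto
    also have "\<dots> \<le> ennreal \<alpha>"
    proof -
      have "c * emeasure (Pi_pmf {..<m} False (\<lambda>_. w)) ?R \<le> 1"
        by (rule ville_queried[OF init_sample[OF \<omega>]])
      then have bound: "inverse (ennreal \<alpha>) * emeasure (Pi_pmf {..<m} False (\<lambda>_. w)) ?R \<le> 1"
        unfolding c_def .
      \<comment> \<open>For \<open>\<alpha> = 0\<close> the level is infinite and the bound forces
        probability 0; otherwise it is multiplied by \<open>\<alpha>\<close>.\<close>
      show ?thesis
      proof (cases "\<alpha> = 0")
        case True
        with bound show ?thesis by (auto simp: ennreal_top_mult top_unique split: if_splits)
      next
        case False
        then have "\<alpha> > 0" using level by auto
        have "emeasure (Pi_pmf {..<m} False (\<lambda>_. w)) ?R =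
          ennreal \<alpha> * (inverse (ennreal \<alpha>) * emeasure (Pi_pmf {..<m} False (\<lambda>_. w)) ?R)"
          using \<open>\<alpha> > 0\<close> by (simp add: inverse_ennreal ennreal_mult[symmetric] mult.assoc[symmetric])
        also have "\<dots> \<le> ennreal \<alpha> * 1"
          by (rule mult_left_mono[OF bound]) simp
        finally show ?thesis by simp
      qed
    qed
    finally show ?thesis .
  qed

  \<comment> \<open>Averaging over label vectors, features and randomization\<close>
  let ?F = "\<lambda>\<eta>. {\<omega> \<in> space M. (\<forall>j\<in>{..<m}. Y j \<omega> = \<eta> j) \<and> (?V \<omega>, ?T \<omega>) \<in> E \<eta>}"
  have F: "?F \<eta> \<in> sets M" for \<eta>
  proof -
    have "{\<omega> \<in> space M. Y j \<omega> = \<eta> j} \<in> sets M" if "j \<in> {..<m}" for j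
    proof -
      have "(\<lambda>\<omega>. (X j \<omega>, Y j \<omega>)) \<in> M \<rightarrow>\<^sub>M pair_space"
        using pool_iid that by (auto simp: indep_vars_def)
      from measurable_sets[OF measurable_compose[OF this measurable_snd], of "{\<eta> j}"] show ?thesis
        by (simp add: vimage_def Int_def conj_commute)
    qed
    then have "{\<omega> \<in> space M. \<forall>j\<in>{..<m}. Y j \<omega> = \<eta> j} \<in> sets M"
      by (intro sets.sets_Collect_finite_All) auto
    moreover have "{\<omega> \<in> space M. (?V \<omega>, ?T \<omega>) \<in> E \<eta>} \<in> sets M" by measurable
    ultimately show ?thesis by (intro sets.sets_Collect_conj)
  qed
  \<comment> \<open>Decomposition by the actual label vector \<open>y \<omega>\<close>, one of
    finitely many.\<close>
  have "emeasure M {\<omega> \<in> space M. \<exists>n\<in>{1..Nq}.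
      test_statistic (\<lambda>i. Q i \<omega>) (\<lambda>i. S i \<omega>) (\<lambda>i. Z i \<omega>) n \<le> ennreal \<alpha>} \<le> emeasure M (\<Union>\<eta>\<in>H. ?F \<eta>)"
  proof (rule emeasure_mono)
    show "{\<omega> \<in> space M. \<exists>n\<in>{1..Nq}.
      test_statistic (\<lambda>i. Q i \<omega>) (\<lambda>i. S i \<omega>) (\<lambda>i. Z i \<omega>) n \<le> ennreal \<alpha>} \<subseteq> (\<Union>\<eta>\<in>H. ?F \<eta>)"
    proof safe
      fix \<omega> n assume "\<omega> \<in> space M" "n \<in> {1..Nq}"
        "test_statistic (\<lambda>i. Q i \<omega>) (\<lambda>i. S i \<omega>) (\<lambda>i. Z i \<omega>) n \<le> ennreal \<alpha>"
      then have "\<omega> \<in> ?F (y \<omega>)" using reject by (auto simp: y_def)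
      moreover have "y \<omega> \<in> H" by (auto simp: H_def PiE_dflt_def y_def)
      ultimately show "\<omega> \<in> (\<Union>\<eta>\<in>H. ?F \<eta>)" by blast
    qed
    show "(\<Union>\<eta>\<in>H. ?F \<eta>) \<in> sets M"
      using F \<open>finite H\<close> by (intro sets.finite_UN) auto
  qed
  also have "\<dots> \<le> (\<Sum>\<eta>\<in>H. emeasure M (?F \<eta>))"
    using F \<open>finite H\<close> by (intro emeasure_subadditive_finite) auto
  \<comment> \<open>\<open>labels\<close> splits off the weight of \<open>\<eta>\<close>; with the
    remaining probability as an integral, the sum can move inside, where \<open>level_bound\<close>
    holds pointwise.\<close>
  also have "\<dots> = (\<Sum>\<eta>\<in>H. \<integral>\<^sup>+ \<omega>. ennreal (pmf (Pi_pmf {..<m} False (\<lambda>_. w)) \<eta>) * indicator (E \<eta>) (?V \<omega>, ?T \<omega>) \<partial>M)"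
  proof (rule sum.cong[OF refl])
    fix \<eta> assume "\<eta> \<in> H"
    have "(\<integral>\<^sup>+ \<omega>. indicator (E \<eta>) (?V \<omega>, ?T \<omega>) \<partial>M) =
      (\<integral>\<^sup>+ \<omega>. indicator {\<omega> \<in> space M. (?V \<omega>, ?T \<omega>) \<in> E \<eta>} \<omega> \<partial>M)"
      by (intro nn_integral_cong) (auto simp: indicator_def)
    also have "\<dots> = emeasure M {\<omega> \<in> space M. (?V \<omega>, ?T \<omega>) \<in> E \<eta>}"
      by (rule nn_integral_indicator) measurable
    finally show "emeasure M (?F \<eta>) =
      (\<integral>\<^sup>+ \<omega>. ennreal (pmf (Pi_pmf {..<m} False (\<lambda>_. w)) \<eta>) * indicator (E \<eta>) (?V \<omega>, ?T \<omega>) \<partial>M)"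
      unfolding labels[OF \<open>\<eta> \<in> H\<close>] by (subst nn_integral_cmult) simp_all
  qed
  also have "\<dots> = (\<integral>\<^sup>+ \<omega>. (\<Sum>\<eta>\<in>H. ennreal (pmf (Pi_pmf {..<m} False (\<lambda>_. w)) \<eta>) * indicator (E \<eta>) (?V \<omega>, ?T \<omega>)) \<partial>M)"
    by (rule nn_integral_sum[symmetric]) measurable
  also have "\<dots> \<le> (\<integral>\<^sup>+ \<omega>. ennreal \<alpha> \<partial>M)"
    using level_bound by (rule nn_integral_mono)
  also have "\<dots> = ennreal \<alpha>"
    by (simp add: emeasure_space_1)
  finally show ?thesis
    using level by (simp add: emeasure_eq_measure)
qed

end
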